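(* Let $n,d\geq2$ and let $\pi_d:\mathrm{SL}(n)^d\to\mathrm{GL}(V_d)$, $V_d=(\mathbb{C}^{n\times n})^{d-1}$, be the natural action of $G=\mathrm{SL}(n)^d$ on representations of the quiver $Q_d$ with dimension vector $(n,\dots,n)$; the representation $\pi_d^n$ (the $n$-fold direct sum of $\pi_d$) corresponds to the $G$-action on the quiver $Q_d^{(n)}$ with dimension vector $(n,\dots,n)$. Then $$\gamma_T(\pi_d)\leq(n-1)^{-d+1}\qquad\text{and}\qquad\gamma_G(\pi_d^n)\leq(n-1)^{-d+1}.$$
   Context: The quiver $Q_d$ has vertices $1,\dots,d$ and, for each $i\in[d-1]$, exactly one arrow between $i$ and $i+1$, directed from whichever of $i,i+1$ has the same parity as $d$ towards the other (so orientations alternate, vertex $d$ is a source and $d-1$ a sink). $Q_d^{(k)}$ is obtained from $Q_d$ by taking $k$ copies of each arrow. A representation with dimension vector $(n,\dots,n)$ assigns an $n\times n$ complex matrix $A_e$ to each arrow $e$; $g=(g_1,\dots,g_d)\in\mathrm{SL}(n)^d$ acts by $(g\cdot A)_e=g_yA_eg_x^{-1}$ for $e:x\to y$. Each copy of $\mathbb{C}^{n\times n}$ carries the trace inner product $\langle X,Y\rangle=\operatorname{tr}(X^\dagger Y)$, and the space of representations the orthogonal sum of these. Let $K=\mathrm{SU}(n)^d$, $T=\mathrm{ST}(n)^d$ (tuples of diagonal determinant-one matrices), $\Pi$ the induced Lie algebra action. For $v\neq0$, $\mu_G(v)$ is the unique $d$-tuple of traceless Hermitian matrices with $\operatorname{tr}(\mu_G(v)A)=\langle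 v,\Pi(A)v\rangle/\langle v,v\rangle$ for all $d$-tuples $A$ of traceless Hermitian matrices (traces of block-diagonal matrices); $\mu_T(v)$ likewise with $A$ and $\mu_T(v)$ ranging over tuples of real traceless diagonal matrices. $v$ is $G$-unstable ($T$-unstable) if $0$ is in the closure of $G\cdot v$ ($T\cdot v$). For a representation $\pi$, the gap is $\gamma_G(\pi)=\min\{\|\mu_G(v)\|_F:v\neq0\ G\text{-unstable}\}$ and the weight margin is $\gamma_T(\pi)=\min\{\|\mu_T(v)\|_F: v\neq0\ T\text{-unstable}\}$. *)

theory Defs
  imports "HOL-Analysis.Analysis"
begin

type_synonym 'n cmat = "complex^'n^'n"

record 'e quiver =
  vertices :: "nat set"
  arrows :: "'e set"
  src :: "'e \<Rightarrow> nat"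
  tgt :: "'e \<Rightarrow> nat"

text \<open>The arrow of \<open>alt_quiver d\<close> joining \<open>i\<close> and \<open>i + 1\<close> is named \<open>i\<close>.\<close>

definition alt_quiver :: "nat \<Rightarrow> nat quiver" where
  "alt_quiver d = \<lparr> vertices = {1..d}, arrows = {1..d - 1},
     src = (\<lambda>i. if even i = even d then i else i + 1),
     tgt = (\<lambda>i. if even i = even d then i + 1 else i) \<rparr>"

definition copies :: "nat \<Rightarrow> 'e quiver \<Rightarrow> ('e \<times> nat) quiver" where
  "copies k Q = \<lparr> vertices = vertices Q, arrows = arrows Q \<times> {1..k},
     src = (\<lambda>e. src Q (fst e)), tgt = (\<lambda>e. tgt Q (fst e)) \<rparr>"

text \<open>
  Throughout, the dimension vector is constant, equal to the cardinality of the index type \<open>'n\<close>.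
  Families of matrices indexed by the arrows, and Lie algebra elements indexed by the vertices,
  are functions that vanish off their index set, so that equality of functions is equality of
  tuples and the product topology on functions induces the Euclidean topology on \<open>reps Q\<close>.
  Group elements are only constrained at the vertices; other values are never used.
\<close>

definition reps :: "'e quiver \<Rightarrow> ('e \<Rightarrow> 'n::finite cmat) set" where
  "reps Q = {v. \<forall>e. e \<notin> arrows Q \<longrightarrow> v e = 0}"

definition SL_tuples :: "'e quiver \<Rightarrow> (nat \<Rightarrow> 'n::finite cmat) set" where
  "SL_tuples Q = {g. \<forall>i\<in>vertices Q. det (g i) = 1}"

definition diagonal :: "'n::finite cmat \<Rightarrow> bool" where
  "diagonal A \<longleftrightarrow> (\<forall>i j. i \<noteq> j \<longrightarrow> A $ i $ j = 0)"

definition ST_tuples :: "'e quiver \<Rightarrow> (nat \<Rightarrow> 'n::finite cmat) set" where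
  "ST_tuples Q = {g \<in> SL_tuples Q. \<forall>i\<in>vertices Q. diagonal (g i)}"

definition act :: "'e quiver \<Rightarrow> (nat \<Rightarrow> 'n::finite cmat) \<Rightarrow> ('e \<Rightarrow> 'n cmat) \<Rightarrow> 'e \<Rightarrow> 'n cmat" where
  "act Q g v = (\<lambda>e. if e \<in> arrows Q
     then g (tgt Q e) ** v e ** matrix_inv (g (src Q e)) else 0)"

text \<open>The action on \<open>copies k Q\<close> is the \<open>k\<close>-fold direct sum of the action on \<open>Q\<close>.\<close>

lemma act_copies:
  "j \<in> {1..k} \<Longrightarrow> act (copies k Q) g v (e, j) = act Q g (\<lambda>e. v (e, j)) e"
  by (simp add: act_def copies_def)

definition unstable ::
  "'e quiver \<Rightarrow> (nat \<Rightarrow> 'n::finite cmat) set \<Rightarrow> ('e \<Rightarrow> 'n cmat) \<Rightarrow> bool" where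
  "unstable Q H v \<longleftrightarrow> (\<lambda>_. 0) \<in> closure ((\<lambda>g. act Q g v) ` H)"

definition mat_exp :: "'n::finite cmat \<Rightarrow> 'n cmat" where
  "mat_exp A = (\<Sum>k. (1 / fact k) *\<^sub>R (((**) A) ^^ k) (mat 1))"

definition lie_act ::
  "'e quiver \<Rightarrow> (nat \<Rightarrow> 'n::finite cmat) \<Rightarrow> ('e \<Rightarrow> 'n cmat) \<Rightarrow> 'e \<Rightarrow> 'n cmat" where
  "lie_act Q A v =
     (\<lambda>e. vector_derivative (\<lambda>t. act Q (\<lambda>i. mat_exp (t *\<^sub>R A i)) v e) (at 0))"

definition conj_transpose :: "'n::finite cmat \<Rightarrow> 'n cmat" where
  "conj_transpose A = (\<chi> i j. cnj (A $ j $ i))"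

definition rep_inner ::
  "'e quiver \<Rightarrow> ('e \<Rightarrow> 'n::finite cmat) \<Rightarrow> ('e \<Rightarrow> 'n cmat) \<Rightarrow> complex" where
  "rep_inner Q v w = (\<Sum>e\<in>arrows Q. trace (conj_transpose (v e) ** w e))"

definition herm_tuples :: "'e quiver \<Rightarrow> (nat \<Rightarrow> 'n::finite cmat) set" where
  "herm_tuples Q = {A. (\<forall>i\<in>vertices Q. conj_transpose (A i) = A i \<and> trace (A i) = 0) \<and>
     (\<forall>i. i \<notin> vertices Q \<longrightarrow> A i = 0)}"

definition real_diag_tuples :: "'e quiver \<Rightarrow> (nat \<Rightarrow> 'n::finite cmat) set" where
  "real_diag_tuples Q = {A. (\<forall>i\<in>vertices Q. diagonal (A i) \<and> (\<forall>j. A i $ j $ j \<in> \<real>) \<and>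
     trace (A i) = 0) \<and> (\<forall>i. i \<notin> vertices Q \<longrightarrow> A i = 0)}"

text \<open>The moment map with values in a space \<open>P\<close> of vertex-indexed tuples of matrices.\<close>

definition moment_map ::
  "'e quiver \<Rightarrow> (nat \<Rightarrow> 'n::finite cmat) set \<Rightarrow> ('e \<Rightarrow> 'n cmat) \<Rightarrow> nat \<Rightarrow> 'n cmat" where
  "moment_map Q P v = (THE M. M \<in> P \<and> (\<forall>A\<in>P. (\<Sum>i\<in>vertices Q. trace (M i ** A i)) =
     rep_inner Q v (lie_act Q A v) / rep_inner Q v v))"

text \<open>The norm of \<^typ>\<open>'n::finite cmat\<close> is the Frobenius norm.\<close>

definition frob_norm :: "'e quiver \<Rightarrow> (nat \<Rightarrow> 'n::finite cmat) \<Rightarrow> real" where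
  "frob_norm Q M = sqrt (\<Sum>i\<in>vertices Q. (norm (M i))\<^sup>2)"

text \<open>
  The minimum over all nonzero unstable vectors is rendered as an infimum of real numbers. The
  argument of type \<^typ>\<open>'n itself\<close> fixes the dimension.
\<close>

definition gap :: "'n::finite itself \<Rightarrow> 'e quiver \<Rightarrow> real" where
  "gap _ Q = Inf {frob_norm Q (moment_map Q (herm_tuples Q) v) | v :: 'e \<Rightarrow> 'n cmat.
     v \<in> reps Q \<and> v \<noteq> (\<lambda>_. 0) \<and> unstable Q (SL_tuples Q) v}"

definition weight_margin :: "'n::finite itself \<Rightarrow> 'e quiver \<Rightarrow> real" where
  "weight_margin _ Q = Inf {frob_norm Q (moment_map Q (real_diag_tuples Q) v) | v :: 'e \<Rightarrow> 'n cmat.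
     v \<in> reps Q \<and> v \<noteq> (\<lambda>_. 0) \<and> unstable Q (ST_tuples Q) v}"

end

theory Submission imports Defs begin

text \<open>
  After a sign change at every vertex of the same parity as \<open>d\<close>, each matrix entry on the arrow
  between \<open>i\<close> and \<open>i + 1\<close> becomes a pair of coordinates, and \<open>\<mu>\<^sub>T\<close> becomes the traceless part of
  the marginals, at the vertices, of the squared moduli of the entries. Fix a coordinate \<open>z\<close> and put
  \<open>m = n - 1\<close>. On the last arrow all pairs \<open>(a, b)\<close> with \<open>a \<noteq> z\<close> get the same weight, so the marginal
  at \<open>d\<close> is uniform and the one at \<open>d - 1\<close> misses \<open>z\<close>. On every earlier arrow only the pairs
  \<open>(a, z)\<close> with \<open>a \<noteq> z\<close> get weight. They supply the missing mass at \<open>z\<close>, and since this mass is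
  spread over the \<open>m\<close> other coordinates of the previous vertex, the defect shrinks by the factor \<open>m\<close>
  in each step. Only vertex 1 keeps a defect, of relative size at most \<open>m\<^bsup>-(d-1)\<^esup>\<close>. A one-parameter
  subgroup whose exponents grow geometrically towards vertex 1 contracts this vector to 0.
\<close>

section \<open>The Lie algebra action\<close>

lemma matrix_inv_eqI:
  fixes A B :: "'a::semiring_1^'n^'n"
  assumes "A ** B = mat 1" and "B ** A = mat 1"
  shows "matrix_inv A = B"
proof -
  have "A ** matrix_inv A = mat 1 \<and> matrix_inv A ** A = mat 1"
    unfolding matrix_inv_def by (rule someI[of _ B]) (simp add: assms)
  then show ?thesis
    by (metis assms(2) matrix_mul_assoc matrix_mul_lid matrix_mul_rid)
qed

lemma matrix_inv_left:
  fixes A :: "'a::semiring_1^'n^'n"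
  assumes "invertible A"
  shows "matrix_inv A ** A = mat 1"
  using assms matrix_inv_eqI unfolding invertible_def by blast

lemma bounded_bilinear_matrix_mult:
  "bounded_bilinear ((**) :: 'n::finite cmat \<Rightarrow> 'n cmat \<Rightarrow> 'n cmat)"
  unfolding bilinear_conv_bounded_bilinear[symmetric] bilinear_def
  by (auto intro!: linearI
      simp: vec_eq_iff matrix_matrix_mult_def sum.distrib algebra_simps scaleR_sum_right)

lemma tendsto_det:
  fixes f :: "'a \<Rightarrow> 'n::finite cmat"
  assumes "(f \<longlongrightarrow> A) F"
  shows "((\<lambda>x. det (f x)) \<longlongrightarrow> det A) F"
  unfolding det_def by (intro tendsto_intros assms)

lemma has_vector_derivative_at_0_iff:
  fixes f :: "real \<Rightarrow> 'a::real_normed_vector"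
  shows "(f has_vector_derivative D) (at 0) \<longleftrightarrow> ((\<lambda>t. (f t - f 0) /\<^sub>R t) \<longlongrightarrow> D) (at 0)"
proof -
  have "norm (f t - f 0 - t *\<^sub>R D) / norm t = norm ((f t - f 0) /\<^sub>R t - D)" if "t \<noteq> 0" for t
  proof -
    have "(f t - f 0) /\<^sub>R t - D = (f t - f 0 - t *\<^sub>R D) /\<^sub>R t"
      using that by (simp add: scaleR_diff_right)
    then show ?thesis by (simp add: divide_inverse_commute)
  qed
  then have "((\<lambda>t. norm (f t - f 0 - t *\<^sub>R D) / norm t) \<longlongrightarrow> 0) (at 0) \<longleftrightarrow>
      ((\<lambda>t. norm ((f t - f 0) /\<^sub>R t - D)) \<longlongrightarrow> 0) (at 0)"
    by (intro tendsto_cong) (auto simp: eventually_at_filter)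
  then show ?thesis
    by (simp add: has_vector_derivative_def has_derivative_at bounded_linear_scaleR_left
        tendsto_norm_zero_iff LIM_zero_iff)
qed

text \<open>Near 0 the inverse \<open>g\<close> satisfies
  \<open>g t - 1 = - g t ** (f t - 1)\<close>. This identity first bounds \<open>g\<close>, then
  shows that \<open>g\<close> is continuous at 0, and after division by \<open>t\<close> yields the
  derivative.\<close>

lemma has_vector_derivative_matrix_inv:
  fixes f :: "real \<Rightarrow> 'n::finite cmat"
  assumes f: "(f has_vector_derivative D) (at 0)" and f0: "f 0 = mat 1"
  shows "((\<lambda>t. matrix_inv (f t)) has_vector_derivative - D) (at 0)"
proof -
  interpret B: bounded_bilinear "(**) :: 'n cmat \<Rightarrow> 'n cmat \<Rightarrow> 'n cmat"
    by (rule bounded_bilinear_matrix_mult)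
  obtain K where K: "K > 0" "\<And>(A :: 'n cmat) (B :: 'n cmat). norm (A ** B) \<le> norm A * norm B * K"
    using B.pos_bounded by auto
  define g where "g t = matrix_inv (f t)" for t
  have flim: "(f \<longlongrightarrow> mat 1) (at 0)"
    using has_vector_derivative_continuous[OF f] f0 by (simp add: continuous_at)
  have "((\<lambda>t. det (f t)) \<longlongrightarrow> 1) (at 0)"
    using tendsto_det[OF flim] by simp
  then have "eventually (\<lambda>t. det (f t) \<noteq> 0) (at 0)"
    by (rule tendsto_imp_eventually_ne) simp
  then have eqn: "eventually (\<lambda>t. g t - mat 1 = - (g t ** (f t - mat 1))) (at 0)"
  proof eventually_elim
    case (elim t)
    then show ?case
      using matrix_inv_left[of "f t"] by (simp add: g_def B.diff_right invertible_det_nz)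
  qed
  \<comment> \<open>Below this threshold the identity gives
    \<open>norm (g t - 1) \<le> norm (g t) / 2\<close>, which can be absorbed on the left:
    \<open>norm (g t)\<close> is at most twice the norm of the identity.\<close>
  have small: "eventually (\<lambda>t. norm (f t - mat 1) < 1 / (2 * K)) (at 0)"
    using flim K(1) by (simp add: tendsto_iff dist_norm)
  have bound: "eventually (\<lambda>t. norm (g t - mat 1) \<le> 2 * norm (mat 1 :: 'n cmat) * K * norm (f t - mat 1)) (at 0)"
    using eqn small
  proof eventually_elim
    case (elim t)
    let ?e = "norm (f t - mat 1)"
    have e: "?e * K \<le> 1/2"
      using elim(2) K(1) by (simp add: field_simps)
    have le: "norm (g t - mat 1) \<le> norm (g t) * ?e * K"
      using elim(1) K(2)[of "g t" "f t - mat 1"] by simp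
    also have "\<dots> \<le> norm (g t) * (1/2)"
      using mult_left_mono[OF e, of "norm (g t)"] by (simp add: mult.assoc)
    finally have "norm (g t) \<le> 2 * norm (mat 1 :: 'n cmat)"
      using norm_triangle_ineq2[of "g t" "mat 1"] by simp
    then have "norm (g t) * (?e * K) \<le> 2 * norm (mat 1 :: 'n cmat) * (?e * K)"
      using K(1) by (intro mult_right_mono) auto
    then show ?case using le by (simp add: mult_ac)
  qed
  have "((\<lambda>t. 2 * norm (mat 1 :: 'n cmat) * K * norm (f t - mat 1)) \<longlongrightarrow> 
      2 * norm (mat 1 :: 'n cmat) * K * norm (mat 1 - mat 1 :: 'n cmat)) (at 0)"
    by (intro tendsto_intros flim)
  then have "((\<lambda>t. g t - mat 1) \<longlongrightarrow> 0) (at 0)"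
    using Lim_null_comparison[OF bound] by simp
  then have glim: "(g \<longlongrightarrow> mat 1) (at 0)"
    by (simp add: LIM_zero_iff)
  have g0: "g 0 = mat 1"
    unfolding g_def f0 by (rule matrix_inv_eqI) auto
  have "((\<lambda>t. - (g t ** ((f t - f 0) /\<^sub>R t))) \<longlongrightarrow> - (mat 1 ** D)) (at 0)"
    using f by (intro tendsto_minus B.tendsto glim) (simp add: has_vector_derivative_at_0_iff)
  moreover have "eventually (\<lambda>t. - (g t ** ((f t - f 0) /\<^sub>R t)) = (g t - g 0) /\<^sub>R t) (at 0)"
    using eqn by eventually_elim (simp add: f0 g0 B.scaleR_right)
  ultimately have "((\<lambda>t. (g t - g 0) /\<^sub>R t) \<longlongrightarrow> - D) (at 0)"
    by (simp add: tendsto_cong)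
  then have "(g has_vector_derivative - D) (at 0)"
    by (simp add: has_vector_derivative_at_0_iff)
  then show ?thesis by (simp add: g_def[abs_def])
qed

section \<open>The power series of the matrix exponential\<close>

lemma funpow_matrix_mult_scaleR:
  fixes A X :: "'n::finite cmat"
  shows "(((**) (t *\<^sub>R A)) ^^ k) X = t ^ k *\<^sub>R (((**) A) ^^ k) X"
proof (induction k)
  case (Suc k)
  interpret B: bounded_bilinear "(**) :: 'n cmat \<Rightarrow> 'n cmat \<Rightarrow> 'n cmat"
    by (rule bounded_bilinear_matrix_mult)
  show ?case
    by (simp only: funpow.simps comp_apply Suc)
      (simp only: B.scaleR_left B.scaleR_right power_Suc2 scaleR_scaleR)
qed simp

text \<open>The terms are dominated by the exponential series at \<open>norm A * K\<close>, where
  \<open>K\<close> is a bound for matrix multiplication as a bilinear map.\<close>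

lemma mat_exp_summable:
  fixes A :: "'n::finite cmat"
  shows "summable (\<lambda>k. norm ((1 / fact k) *\<^sub>R (((**) A) ^^ k) (mat 1)))"
proof -
  interpret B: bounded_bilinear "(**) :: 'n cmat \<Rightarrow> 'n cmat \<Rightarrow> 'n cmat"
    by (rule bounded_bilinear_matrix_mult)
  obtain K where K: "K > 0" "\<And>(A :: 'n cmat) (B :: 'n cmat). norm (A ** B) \<le> norm A * norm B * K"
    using B.pos_bounded by auto
  have bnd: "norm ((((**) A) ^^ k) (mat 1)) \<le> (norm A * K) ^ k * norm (mat 1 :: 'n cmat)" for k
  proof (induction k)
    case (Suc k)
    have "norm ((((**) A) ^^ Suc k) (mat 1)) \<le> norm A * K * norm ((((**) A) ^^ k) (mat 1))"
      using K(2)[of A "(((**) A) ^^ k) (mat 1)"] by (simp add: mult_ac)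
    also have "\<dots> \<le> norm A * K * ((norm A * K) ^ k * norm (mat 1 :: 'n cmat))"
      using K(1) by (intro mult_left_mono Suc) auto
    finally show ?case by (simp add: mult_ac)
  qed simp
  have "summable (\<lambda>k. inverse (fact k) * (norm A * K) ^ k * norm (mat 1 :: 'n cmat))"
    by (intro summable_mult2 summable_exp)
  then show ?thesis
  proof (rule summable_comparison_test[rotated], intro exI allI impI)
    fix k :: nat
    show "norm (norm ((1 / fact k) *\<^sub>R (((**) A) ^^ k) (mat 1)))
        \<le> inverse (fact k) * (norm A * K) ^ k * norm (mat 1 :: 'n cmat)"
      using mult_left_mono[OF bnd, of "1 / fact k" k] by (simp add: inverse_eq_divide)
  qed
qed

lemma mat_exp_0 [simp]: "mat_exp (0 :: 'n::finite cmat) = mat 1"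
proof -
  have "(1 / fact k) *\<^sub>R (((**) (0::'n cmat)) ^^ k) (mat 1) = (if k = 0 then mat 1 else 0)" for k
    by (cases k) auto
  then show ?thesis
    unfolding mat_exp_def using sums_single[of 0 "\<lambda>_. mat 1 :: 'n cmat"] by (simp add: sums_iff)
qed

lemma has_vector_derivative_mat_exp:
  fixes A :: "'n::finite cmat"
  shows "((\<lambda>t. mat_exp (t *\<^sub>R A)) has_vector_derivative A) (at 0)"
proof -
  define c where "c k = (1 / fact k) *\<^sub>R (((**) A) ^^ k) (mat 1)" for k
  have sc: "summable (\<lambda>k. norm (c k))"
    unfolding c_def by (rule mat_exp_summable)
  have sc2: "summable (\<lambda>k. norm (c (k + 2)))"
    using sc by (subst summable_iff_shift)
  \<comment> \<open>The terms dropped are \<open>mat 1\<close> and \<open>A\<close>. For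
    \<open>\<bar>t\<bar> < 1\<close> the rest of the difference quotient is \<open>t\<close> times a
    series whose norm is at most \<open>C\<close>.\<close>
  define C where "C = (\<Sum>k. norm (c (k + 2)))"
  have est: "norm ((mat_exp (t *\<^sub>R A) - mat 1) /\<^sub>R t - A) \<le> \<bar>t\<bar> * C" if t: "t \<noteq> 0" "\<bar>t\<bar> < 1" for t
  proof -
    have pw: "norm (t ^ k *\<^sub>R c (k + 2)) \<le> norm (c (k + 2))" for k
      using t by (simp add: power_abs power_le_one mult_left_le_one_le)
    have s2: "summable (\<lambda>k. norm (t ^ k *\<^sub>R c (k + 2)))"
      by (rule summable_comparison_test[OF _ sc2]) (use pw in auto)
    have "summable (\<lambda>k. t\<^sup>2 *\<^sub>R (t ^ k *\<^sub>R c (k + 2)))"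
      by (intro summable_scaleR_right summable_norm_cancel[OF s2])
    then have s: "summable (\<lambda>k. t ^ (k + 2) *\<^sub>R c (k + 2))"
      by (simp add: power_add power2_eq_square mult_ac)
    then have s': "summable (\<lambda>k. t ^ k *\<^sub>R c k)"
      by (subst (asm) summable_iff_shift)
    have "mat_exp (t *\<^sub>R A) = (\<Sum>k. t ^ k *\<^sub>R c k)"
      by (simp add: mat_exp_def c_def funpow_matrix_mult_scaleR mult.commute)
    also have "\<dots> = (\<Sum>k. t ^ (k + 2) *\<^sub>R c (k + 2)) + (\<Sum>k<2. t ^ k *\<^sub>R c k)"
      by (rule suminf_split_initial_segment[OF s'])
    also have "(\<Sum>k<2. t ^ k *\<^sub>R c k) = mat 1 + t *\<^sub>R A"
      by (simp add: c_def numeral_2_eq_2)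
    also have "(\<Sum>k. t ^ (k + 2) *\<^sub>R c (k + 2)) = t\<^sup>2 *\<^sub>R (\<Sum>k. t ^ k *\<^sub>R c (k + 2))"
      using suminf_scaleR_right[OF summable_norm_cancel[OF s2], of "t\<^sup>2"]
      by (simp add: power_add power2_eq_square mult_ac)
    finally have "(mat_exp (t *\<^sub>R A) - mat 1) /\<^sub>R t - A = t *\<^sub>R (\<Sum>k. t ^ k *\<^sub>R c (k + 2))"
      using t by (simp add: algebra_simps power2_eq_square)
    moreover have "norm (\<Sum>k. t ^ k *\<^sub>R c (k + 2)) \<le> C"
      unfolding C_def by (rule order_trans[OF summable_norm[OF s2] suminf_le[OF pw s2 sc2]])
    ultimately show ?thesis by (simp add: mult_left_mono)
  qed
  have "eventually (\<lambda>t. norm ((mat_exp (t *\<^sub>R A) - mat 1) /\<^sub>R t - A) \<le> \<bar>t\<bar> * C) (at 0)"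
    unfolding eventually_at by (rule exI[of _ 1]) (auto intro: est)
  moreover have "((\<lambda>t. \<bar>t\<bar> * C) \<longlongrightarrow> \<bar>0\<bar> * C) (at (0::real))"
    by (intro tendsto_intros)
  ultimately have "((\<lambda>t. (mat_exp (t *\<^sub>R A) - mat 1) /\<^sub>R t - A) \<longlongrightarrow> 0) (at 0)"
    using Lim_null_comparison by fastforce
  then show ?thesis
    by (simp add: has_vector_derivative_at_0_iff LIM_zero_iff)
qed

text \<open>Product rule: the left factor differentiates to \<open>A (tgt Q e)\<close> and the
  inverse on the right to \<open>- A (src Q e)\<close>. All later computations use this closed form
  instead of the derivative.\<close>

lemma lie_act_eq:
  "lie_act Q A v = (\<lambda>e. if e \<in> arrows Q then A (tgt Q e) ** v e - v e ** A (src Q e) else 0)"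
proof
  fix e
  interpret B: bounded_bilinear "(**) :: 'b cmat \<Rightarrow> 'b cmat \<Rightarrow> 'b cmat"
    by (rule bounded_bilinear_matrix_mult)
  let ?E = "\<lambda>i t. mat_exp (t *\<^sub>R A i)"
  have "((\<lambda>t. ?E (tgt Q e) t ** v e ** matrix_inv (?E (src Q e) t)) has_vector_derivative
      (?E (tgt Q e) 0 ** v e) ** (- A (src Q e)) + (A (tgt Q e) ** v e) ** matrix_inv (?E (src Q e) 0)) (at 0)"
    using bounded_linear.has_vector_derivative[OF B.bounded_linear_left has_vector_derivative_mat_exp]
    by (intro B.has_vector_derivative has_vector_derivative_matrix_inv has_vector_derivative_mat_exp) auto
  moreover have "matrix_inv (mat 1 :: 'b cmat) = mat 1"
    by (rule matrix_inv_eqI) auto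
  ultimately have "((\<lambda>t. ?E (tgt Q e) t ** v e ** matrix_inv (?E (src Q e) t)) has_vector_derivative
      A (tgt Q e) ** v e - v e ** A (src Q e)) (at 0)"
    by (simp add: B.minus_right)
  then show "lie_act Q A v e = (if e \<in> arrows Q then A (tgt Q e) ** v e - v e ** A (src Q e) else 0)"
    by (simp add: lie_act_def act_def vector_derivative_at)
qed

section \<open>Moment maps and instability\<close>

text \<open>The hypotheses kill every contribution of off-diagonal entries of \<open>A\<close> and
  \<open>B\<close>. They are met in two ways: when \<open>A\<close> and \<open>B\<close> are
  diagonal, and when \<open>X\<close> has at most one nonzero entry in each row and column.\<close>

lemma trace_moment_eq:
  fixes X A B :: "'n::finite cmat"
  assumes B: "\<And>a a' b. a \<noteq> a' \<Longrightarrow> cnj (X $ a $ b) * (B $ a $ a' * X $ a' $ b) = 0"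
    and A: "\<And>a b b'. b \<noteq> b' \<Longrightarrow> cnj (X $ a $ b) * (X $ a $ b' * A $ b' $ b) = 0"
  shows "trace (conj_transpose X ** (B ** X - X ** A)) =
    (\<Sum>a\<in>UNIV. \<Sum>b\<in>UNIV. of_real ((cmod (X $ a $ b))\<^sup>2) * (B $ a $ a - A $ b $ b))"
proof -
  have B': "cnj (X $ a $ b) * (\<Sum>a'\<in>UNIV. B $ a $ a' * X $ a' $ b) =
      of_real ((cmod (X $ a $ b))\<^sup>2) * B $ a $ a" for a b
  proof -
    have "(\<Sum>a'\<in>UNIV. cnj (X $ a $ b) * (B $ a $ a' * X $ a' $ b)) =
        (\<Sum>a'\<in>{a}. cnj (X $ a $ b) * (B $ a $ a' * X $ a' $ b))"
      by (rule sum.mono_neutral_right) (auto simp: B)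
    then show ?thesis
      unfolding complex_norm_square by (simp add: sum_distrib_left mult_ac)
  qed
  have A': "cnj (X $ a $ b) * (\<Sum>b'\<in>UNIV. X $ a $ b' * A $ b' $ b) =
      of_real ((cmod (X $ a $ b))\<^sup>2) * A $ b $ b" for a b
  proof -
    have "(\<Sum>b'\<in>UNIV. cnj (X $ a $ b) * (X $ a $ b' * A $ b' $ b)) =
        (\<Sum>b'\<in>{b}. cnj (X $ a $ b) * (X $ a $ b' * A $ b' $ b))"
      by (rule sum.mono_neutral_right) (auto simp: A)
    then show ?thesis
      unfolding complex_norm_square by (simp add: sum_distrib_left mult_ac)
  qed
  have "trace (conj_transpose X ** (B ** X - X ** A)) =
      (\<Sum>b\<in>UNIV. \<Sum>a\<in>UNIV. cnj (X $ a $ b) * (\<Sum>a'\<in>UNIV. B $ a $ a' * X $ a' $ b) -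
         cnj (X $ a $ b) * (\<Sum>b'\<in>UNIV. X $ a $ b' * A $ b' $ b))"
    by (simp add: trace_def conj_transpose_def matrix_matrix_mult_def right_diff_distrib)
  also have "\<dots> = (\<Sum>b\<in>UNIV. \<Sum>a\<in>UNIV. of_real ((cmod (X $ a $ b))\<^sup>2) * (B $ a $ a - A $ b $ b))"
    by (simp only: A' B' right_diff_distrib)
  finally show ?thesis by (subst (asm) sum.swap)
qed

lemma trace_conj_transpose_self:
  fixes X :: "'n::finite cmat"
  shows "trace (conj_transpose X ** X) = of_real (\<Sum>a\<in>UNIV. \<Sum>b\<in>UNIV. (cmod (X $ a $ b))\<^sup>2)"
proof -
  have "trace (conj_transpose X ** X) = (\<Sum>b\<in>UNIV. \<Sum>a\<in>UNIV. of_real ((cmod (X $ a $ b))\<^sup>2))"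
    unfolding complex_norm_square
    by (simp add: trace_def conj_transpose_def matrix_matrix_mult_def mult.commute)
  then show ?thesis by (subst (asm) sum.swap) simp
qed

lemma norm_matrix_power2:
  fixes X :: "'n::finite cmat"
  shows "(norm X)\<^sup>2 = (\<Sum>a\<in>UNIV. \<Sum>b\<in>UNIV. (cmod (X $ a $ b))\<^sup>2)"
  by (simp add: norm_vec_def L2_set_def sum_nonneg)

lemma real_diag_tuples_subset_herm_tuples: "real_diag_tuples Q \<subseteq> herm_tuples Q"
proof
  fix A :: "nat \<Rightarrow> 'a cmat" assume A: "A \<in> real_diag_tuples Q"
  have "conj_transpose (A i) = A i" if "i \<in> vertices Q" for i
  proof -
    have "cnj (A i $ b $ a) = A i $ a $ b" for a b
      using A that by (cases "a = b") (auto simp: real_diag_tuples_def diagonal_def Reals_cnj_iff)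
    then show ?thesis by (simp add: conj_transpose_def vec_eq_iff)
  qed
  then show "A \<in> herm_tuples Q" using A by (auto simp: herm_tuples_def real_diag_tuples_def)
qed

text \<open>Only uniqueness needs an argument. The difference of two candidates lies in
  \<open>P\<close>, so it may be paired with itself; the result is 0 and, by Hermitian symmetry,
  also the sum of its squared Frobenius norms.\<close>

lemma moment_map_eqI:
  fixes P :: "(nat \<Rightarrow> 'n::finite cmat) set"
  assumes fin: "finite (vertices Q)" and P: "P \<subseteq> herm_tuples Q"
    and diff: "\<And>A B. A \<in> P \<Longrightarrow> B \<in> P \<Longrightarrow> (\<lambda>i. A i - B i) \<in> P"
    and M: "M \<in> P"
    and eq: "\<And>A. A \<in> P \<Longrightarrow>
      (\<Sum>i\<in>vertices Q. trace (M i ** A i)) = rep_inner Q v (lie_act Q A v) / rep_inner Q v v"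
  shows "moment_map Q P v = M"
  unfolding moment_map_def
proof (rule the_equality)
  show "M \<in> P \<and> (\<forall>A\<in>P. (\<Sum>i\<in>vertices Q. trace (M i ** A i)) =
      rep_inner Q v (lie_act Q A v) / rep_inner Q v v)"
    using M eq by blast
next
  interpret B: bounded_bilinear "(**) :: 'n cmat \<Rightarrow> 'n cmat \<Rightarrow> 'n cmat"
    by (rule bounded_bilinear_matrix_mult)
  fix M' assume M': "M' \<in> P \<and> (\<forall>A\<in>P. (\<Sum>i\<in>vertices Q. trace (M' i ** A i)) =
      rep_inner Q v (lie_act Q A v) / rep_inner Q v v)"
  define D where "D i = M' i - M i" for i
  have D: "D \<in> P" unfolding D_def using diff M M' by blast
  have "(\<Sum>i\<in>vertices Q. trace (D i ** D i)) =
      (\<Sum>i\<in>vertices Q. trace (M' i ** D i)) - (\<Sum>i\<in>vertices Q. trace (M i ** D i))"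
    by (simp add: D_def[of i for i] B.diff_left trace_sub sum_subtractf)
  also have "\<dots> = 0" using M' D eq[OF D] by auto
  also have "(\<Sum>i\<in>vertices Q. trace (D i ** D i)) =
      (\<Sum>i\<in>vertices Q. trace (conj_transpose (D i) ** D i))"
    using D P by (intro sum.cong) (auto simp: herm_tuples_def)
  also have "\<dots> = of_real (\<Sum>i\<in>vertices Q. (norm (D i))\<^sup>2)"
    by (simp add: trace_conj_transpose_self norm_matrix_power2)
  finally have "(\<Sum>i\<in>vertices Q. (norm (D i))\<^sup>2) = 0"
    by (simp only: of_real_eq_0_iff)
  then have "D i = 0" if "i \<in> vertices Q" for i
    using fin that by (simp add: sum_nonneg_eq_0_iff)
  moreover have "D i = 0" if "i \<notin> vertices Q" for i
    using D P that by (auto simp: herm_tuples_def)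
  ultimately show "M' = M" unfolding D_def by (metis eq_iff_diff_eq_0 ext)
qed

lemma tendsto_funI:
  fixes f :: "'a \<Rightarrow> 'b \<Rightarrow> 'c::topological_space"
  assumes "\<And>i. ((\<lambda>x. f x i) \<longlongrightarrow> l i) F"
  shows "(f \<longlongrightarrow> l) F"
proof -
  have "limitin (product_topology (\<lambda>i. euclidean) UNIV) f l F"
    using assms by (simp add: limitin_componentwise)
  then show ?thesis by (simp add: euclidean_product_topology)
qed

lemma unstable_mono: "unstable Q H v \<Longrightarrow> H \<subseteq> H' \<Longrightarrow> unstable Q H' v"
  unfolding unstable_def by (meson closure_mono image_mono subsetD)

section \<open>Contraction by diagonal one-parameter subgroups\<close>

definition diag_mat :: "('n \<Rightarrow> 'a) \<Rightarrow> 'a::zero^'n^'n" where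
  "diag_mat f = (\<chi> a b. if a = b then f a else 0)"

lemma diag_mat_nth [simp]: "diag_mat f $ a $ b = (if a = b then f a else 0)"
  by (simp add: diag_mat_def)

lemma diag_mat_mult_left_nth:
  fixes X :: "'a::semiring_1^'m^'n::finite"
  shows "(diag_mat f ** X) $ a $ b = f a * X $ a $ b"
  by (simp add: matrix_matrix_mult_def if_distrib[of "\<lambda>x. x * _"] cong: if_cong)

lemma diag_mat_mult_right_nth:
  fixes X :: "'a::semiring_1^'m::finite^'n"
  shows "(X ** diag_mat f) $ a $ b = X $ a $ b * f b"
  by (simp add: matrix_matrix_mult_def if_distrib[of "\<lambda>x. _ * x"] cong: if_cong)

text \<open>The easy direction of the Hilbert-Mumford criterion. The subgroup
  \<open>exp (t * h)\<close> multiplies the entry at row \<open>a\<close> and column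
  \<open>b\<close> by the exponential of \<open>t\<close> times a negative number; zero exponent
  sums keep the determinants equal to 1.\<close>

lemma unstable_if_one_parameter_subgroup:
  fixes h :: "nat \<Rightarrow> 'n::finite \<Rightarrow> real"
  assumes h0: "\<And>i. i \<in> vertices Q \<Longrightarrow> (\<Sum>a\<in>UNIV. h i a) = 0"
    and neg: "\<And>e a b. e \<in> arrows Q \<Longrightarrow> v e $ a $ b \<noteq> 0 \<Longrightarrow> h (tgt Q e) a < h (src Q e) b"
  shows "unstable Q (ST_tuples Q) v"
proof -
  define g :: "real \<Rightarrow> nat \<Rightarrow> 'n cmat"
    where "g t i = diag_mat (\<lambda>a. of_real (exp (t * h i a)))" for t i
  have g: "g t \<in> ST_tuples Q" for t
  proof -
    have "det (g t i) = 1" if "i \<in> vertices Q" for i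
    proof -
      have "det (g t i) = of_real (\<Prod>a\<in>UNIV. exp (t * h i a))"
        by (subst det_diagonal) (auto simp: g_def)
      also have "(\<Prod>a\<in>UNIV. exp (t * h i a)) = 1"
        using h0[OF that] by (simp add: exp_sum[symmetric] sum_distrib_left[symmetric])
      finally show ?thesis by simp
    qed
    then show ?thesis by (auto simp: ST_tuples_def SL_tuples_def diagonal_def g_def)
  qed
  have inv: "matrix_inv (g t i) = diag_mat (\<lambda>a. of_real (exp (- (t * h i a))))" for t i
    by (rule matrix_inv_eqI)
      (auto simp: g_def vec_eq_iff diag_mat_mult_left_nth mat_def exp_minus)
  have act: "act Q (g t) v e $ a $ b = exp (t * (h (tgt Q e) a - h (src Q e) b)) *\<^sub>R (v e $ a $ b)"
    if "e \<in> arrows Q" for t e a b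
    using that unfolding act_def inv
    by (simp add: g_def diag_mat_mult_left_nth diag_mat_mult_right_nth exp_diff exp_minus
        right_diff_distrib scaleR_conv_of_real field_simps)
  have "((\<lambda>t. act Q (g t) v e $ a $ b) \<longlongrightarrow> 0) at_top" for e a b
  proof (cases "e \<in> arrows Q \<and> v e $ a $ b \<noteq> 0")
    case True
    have "filterlim (\<lambda>t. t * (h (tgt Q e) a - h (src Q e) b)) at_bot at_top"
      using neg[of e a b] True
      by (intro filterlim_tendsto_neg_mult_at_bot[OF tendsto_const _ filterlim_ident, simplified mult.commute]) auto
    then have "((\<lambda>t. exp (t * (h (tgt Q e) a - h (src Q e) b))) \<longlongrightarrow> 0) at_top"
      by (rule filterlim_compose[OF exp_at_bot])
    then have "((\<lambda>t. exp (t * (h (tgt Q e) a - h (src Q e) b)) *\<^sub>R (v e $ a $ b)) \<longlongrightarrow> 0 *\<^sub>R (v e $ a $ b)) at_top"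
      by (intro tendsto_intros)
    then show ?thesis using True by (simp add: act)
  next
    case False
    then have "act Q (g t) v e $ a $ b = 0" for t
      by (cases "e \<in> arrows Q") (auto simp: act, simp add: act_def)
    then show ?thesis by simp
  qed
  then have "((\<lambda>t. act Q (g t) v) \<longlongrightarrow> (\<lambda>_. 0)) at_top"
    by (intro tendsto_funI vec_tendstoI) simp
  then show ?thesis
    unfolding unstable_def
    by (rule Lim_in_closed_set[rotated -1])
      (auto intro!: always_eventually closure_subset[THEN subsetD] imageI g)
qed

section \<open>The chain of weights\<close>

lemma sum_UNIV_neq:
  fixes f :: "'n::finite \<Rightarrow> 'a::ab_group_add"
  shows "(\<Sum>a\<in>UNIV. if a = z then 0 else f a) = (\<Sum>a\<in>UNIV. f a) - f z"
proof -
  have "(\<Sum>a\<in>UNIV. if a = z then 0 else f a) = (\<Sum>a\<in>UNIV. f a - (if a = z then f a else 0))"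
    by (intro sum.cong) auto
  then show ?thesis by (simp add: sum_subtractf)
qed

text \<open>
  Here \<open>z\<close> is a distinguished coordinate; \<open>chain_weight d z j a b\<close> is the squared modulus of the
  entry of the matrix on arrow \<open>j\<close> that joins coordinate \<open>a\<close> at vertex \<open>j\<close> to coordinate \<open>b\<close> at
  vertex \<open>j + 1\<close>, whatever the direction of the arrow.
\<close>

definition chain_weight :: "nat \<Rightarrow> 'n::finite \<Rightarrow> nat \<Rightarrow> 'n \<Rightarrow> 'n \<Rightarrow> real" where
  "chain_weight d z j a b =
    (if a = z then 0 else if j = d - 1 then 1 / (real CARD('n) - 1)
     else if b = z then real CARD('n) / (real CARD('n) - 1) ^ (d - j) else 0)"

text \<open>The squared norm of the representation, hence the denominator in the moment map.\<close>

definition chain_mass :: "nat \<Rightarrow> 'n::finite \<Rightarrow> real" where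
  "chain_mass d z = (\<Sum>j=1..d-1. \<Sum>a\<in>UNIV. \<Sum>b\<in>UNIV. chain_weight d z j a b)"

text \<open>Vertices of the parity of \<open>d\<close> are sources, and there the Lie algebra acts
  by \<open>- v ** A\<close>; at sinks it acts by \<open>A ** v\<close>.\<close>

definition chain_sign :: "nat \<Rightarrow> nat \<Rightarrow> real" where
  "chain_sign d i = (if even i = even d then - 1 else 1)"

text \<open>Columns belong to the source of the arrow and rows to its target. If \<open>j\<close>
  has the parity of \<open>d\<close>, then \<open>j\<close> is the source and its coordinate is the
  column index.\<close>

definition chain_rep :: "nat \<Rightarrow> 'n::finite \<Rightarrow> nat \<Rightarrow> 'n cmat" where
  "chain_rep d z j = (\<chi> r c. of_real (sqrt
     (if even j = even d then chain_weight d z j c r else chain_weight d z j r c)))"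

text \<open>At vertex 1 this is the traceless part of a multiple of the matrix unit at
  \<open>(z, z)\<close>; the multiple is the uncancelled term of \<open>chain_weight_pairing\<close>
  with the sign of vertex 1, divided by the squared norm.\<close>

definition chain_moment :: "nat \<Rightarrow> 'n::finite \<Rightarrow> nat \<Rightarrow> 'n cmat" where
  "chain_moment d z i = (if i = 1 then diag_mat (\<lambda>a. of_real (chain_sign d 1 *
     (real CARD('n) / (real CARD('n) - 1) ^ (d - 1) / chain_mass d z) *
     (1 / real CARD('n) - (if a = z then 1 else 0)))) else 0)"

lemma chain_weight_nonneg: "chain_weight d (z :: 'n::finite) j a b \<ge> 0"
proof -
  have "real CARD('n) \<ge> 1" by (simp add: Suc_leI)
  then show ?thesis by (auto simp: chain_weight_def)
qed

text \<open>The last arrow alone has mass \<open>n\<close>: there are \<open>n - 1\<close> rows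
  \<open>a \<noteq> z\<close>, each of mass \<open>n / (n - 1)\<close>.\<close>

lemma chain_mass_ge:
  fixes z :: "'n::finite"
  assumes n: "CARD('n) \<ge> 2" and d: "d \<ge> 2"
  shows "chain_mass d z \<ge> real CARD('n)"
proof -
  have "(\<Sum>a\<in>UNIV. \<Sum>b\<in>UNIV. chain_weight d z (d - 1) a b) =
      (\<Sum>a\<in>UNIV. if a = z then 0 else real CARD('n) / (real CARD('n) - 1))"
    by (intro sum.cong) (auto simp: chain_weight_def)
  also have "\<dots> = real CARD('n)"
  proof -
    have "real CARD('n) - 1 \<noteq> 0" using n by simp
    then have "real CARD('n) * (real CARD('n) / (real CARD('n) - 1)) - real CARD('n) / (real CARD('n) - 1)
        = real CARD('n)"
      by (simp add: divide_simps) (simp add: algebra_simps)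
    then show ?thesis by (simp add: sum_UNIV_neq)
  qed
  finally have "(\<Sum>a\<in>UNIV. \<Sum>b\<in>UNIV. chain_weight d z (d - 1) a b) = real CARD('n)" .
  moreover have "(\<Sum>a\<in>UNIV. \<Sum>b\<in>UNIV. chain_weight d z (d - 1) a b) \<le> chain_mass d z"
    unfolding chain_mass_def using d
    by (intro member_le_sum[where i = "d - 1"]) (auto intro!: sum_nonneg chain_weight_nonneg)
  ultimately show ?thesis by simp
qed

text \<open>
  Coordinates other than \<open>z\<close> at vertex \<open>j + 1\<close> receive from arrow \<open>j + 1\<close> exactly what \<open>z\<close>
  receives from arrow \<open>j\<close>, so the marginals are uniform everywhere except at vertex 1.
\<close>

lemma chain_weight_pairing:
  fixes X :: "nat \<Rightarrow> 'n::finite \<Rightarrow> complex"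
  assumes n: "CARD('n) \<ge> 2" and d: "d \<ge> 2"
    and X: "\<And>i. i \<in> {1..d} \<Longrightarrow> (\<Sum>a\<in>UNIV. X i a) = 0"
  shows "(\<Sum>j=1..d-1. \<Sum>a\<in>UNIV. \<Sum>b\<in>UNIV. of_real (chain_weight d z j a b) * (X j a + X (j + 1) b))
    = - of_real (real CARD('n) / (real CARD('n) - 1) ^ (d - 1)) * X 1 z"
proof -
  let ?n = "of_nat CARD('n) :: complex"
  \<comment> \<open>The sum over arrow \<open>j\<close> will be \<open>F (j + 1) - F j\<close>, so
    the total telescopes to \<open>- F 1\<close>. Setting \<open>F d = 0\<close> reflects the
    uniform marginal at vertex \<open>d\<close>, which pairs to 0 with a traceless element.\<close>
  define F where "F j = (if j = d then 0 else ?n / (?n - 1) ^ (d - j) * X j z)" for j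
  have n1: "?n - 1 \<noteq> 0"
    using n by (metis One_nat_def eq_iff_diff_eq_0 not_less_eq_eq numeral_2_eq_2 of_nat_1 of_nat_eq_iff order_refl)
  have card_neq: "(\<Sum>a\<in>UNIV. if a = z then 0 else x) = (?n - 1) * x" for x :: complex
    by (simp add: sum_UNIV_neq left_diff_distrib)
  have step: "(\<Sum>a\<in>UNIV. \<Sum>b\<in>UNIV. of_real (chain_weight d z j a b) * (X j a + X (j + 1) b))
      = F (Suc j) - F j" if j: "j \<in> {1..<d}" for j
  proof (cases "j = d - 1")
    case True
    have "(\<Sum>a\<in>UNIV. \<Sum>b\<in>UNIV. of_real (chain_weight d z j a b) * (X j a + X (j + 1) b))
        = (\<Sum>a\<in>UNIV. if a = z then 0 else ?n / (?n - 1) * X j a)"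
    proof (intro sum.cong refl)
      fix a
      have "(\<Sum>b\<in>UNIV. 1 / (?n - 1) * (X j a + X (j + 1) b)) = ?n / (?n - 1) * X j a"
        using X[of "j + 1"] j by (simp add: sum_distrib_left[symmetric] sum_divide_distrib[symmetric] sum.distrib)
      then show "(\<Sum>b\<in>UNIV. of_real (chain_weight d z j a b) * (X j a + X (j + 1) b)) =
          (if a = z then 0 else ?n / (?n - 1) * X j a)"
        using True by (simp add: chain_weight_def)
    qed
    also have "\<dots> = - (?n / (?n - 1) * X j z)"
      using X[of j] j by (simp only: sum_UNIV_neq sum_distrib_left[symmetric]) simp
    finally show ?thesis using True d by (simp add: F_def)
  next
    case False
    let ?K = "?n / (?n - 1) ^ (d - j)"
    have "(\<Sum>a\<in>UNIV. \<Sum>b\<in>UNIV. of_real (chain_weight d z j a b) * (X j a + X (j + 1) b))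
        = (\<Sum>a\<in>UNIV. (if a = z then 0 else ?K * X j a) + (if a = z then 0 else ?K * X (j + 1) z))"
    proof (intro sum.cong refl)
      fix a
      have "(\<Sum>b\<in>UNIV. of_real (chain_weight d z j a b) * (X j a + X (j + 1) b)) =
          (\<Sum>b\<in>UNIV. if b = z then if a = z then 0 else ?K * (X j a + X (j + 1) z) else 0)"
        using False by (intro sum.cong) (auto simp: chain_weight_def)
      then show "(\<Sum>b\<in>UNIV. of_real (chain_weight d z j a b) * (X j a + X (j + 1) b)) =
          (if a = z then 0 else ?K * X j a) + (if a = z then 0 else ?K * X (j + 1) z)"
        by (simp add: distrib_left)
    qed
    also have "\<dots> = (\<Sum>a\<in>UNIV. ?K * X j a) - ?K * X j z + (?n - 1) * (?K * X (j + 1) z)"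
      by (simp only: sum.distrib card_neq) (simp only: sum_UNIV_neq)
    also have "(\<Sum>a\<in>UNIV. ?K * X j a) = 0"
      using X[of j] j by (simp only: sum_distrib_left[symmetric]) simp
    \<comment> \<open>Each of the \<open>n - 1\<close> coordinates \<open>a \<noteq> z\<close> sends
      weight \<open>?K\<close> to \<open>z\<close>, which lowers the exponent in the denominator by
      one and produces the coefficient of the next arrow.\<close>
    also have "(?n - 1) * (?K * X (j + 1) z) = F (Suc j)"
    proof -
      have "d - j = Suc (d - Suc j)" "Suc j \<noteq> d" using j False by auto
      then show ?thesis using n1 by (simp add: F_def)
    qed
    finally show ?thesis using j by (simp add: F_def)
  qed
  have "{1..d-1} = {1..<d}" using d by auto
  then have "(\<Sum>j=1..d-1. \<Sum>a\<in>UNIV. \<Sum>b\<in>UNIV. of_real (chain_weight d z j a b) * (X j a + X (j + 1) b))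
    = (\<Sum>j=1..<d. F (Suc j) - F j)"
    by (simp only: step cong: sum.cong)
  also have "\<dots> = F d - F 1" using d by (intro sum_Suc_diff') simp
  finally show ?thesis using d by (simp add: F_def)
qed

lemma chain_rep_pairing:
  fixes Y :: "nat \<Rightarrow> 'n::finite \<Rightarrow> complex"
  shows "(\<Sum>r\<in>UNIV. \<Sum>c\<in>UNIV. of_real ((cmod (chain_rep d z j $ r $ c))\<^sup>2) *
      (Y (tgt (alt_quiver d) j) r - Y (src (alt_quiver d) j) c)) =
    (\<Sum>a\<in>UNIV. \<Sum>b\<in>UNIV. of_real (chain_weight d z j a b) *
      (of_real (chain_sign d j) * Y j a + of_real (chain_sign d (j + 1)) * Y (j + 1) b))"
proof (cases "even j = even d")
  case True
  then show ?thesis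
    by (subst sum.swap) (auto simp: chain_rep_def alt_quiver_def chain_sign_def chain_weight_nonneg
        intro!: sum.cong)
next
  case False
  then show ?thesis
    by (auto simp: chain_rep_def alt_quiver_def chain_sign_def chain_weight_nonneg intro!: sum.cong)
qed

lemma sum_chain_rep_power2:
  "(\<Sum>r\<in>UNIV. \<Sum>c\<in>UNIV. (cmod (chain_rep d z j $ r $ c))\<^sup>2) =
    (\<Sum>a\<in>UNIV. \<Sum>b\<in>UNIV. chain_weight d (z :: 'n::finite) j a b)"
proof (cases "even j = even d")
  case True
  then show ?thesis by (subst sum.swap) (simp add: chain_rep_def chain_weight_nonneg)
qed (simp add: chain_rep_def chain_weight_nonneg)

section \<open>The moment tuple and its norm\<close>

lemma chain_moment_in_real_diag_tuples:
  fixes z :: "'n::finite"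
  assumes "vertices Q = {1..d}" and "d \<ge> 2"
  shows "chain_moment d z \<in> real_diag_tuples Q"
proof -
  have "trace (chain_moment d z 1) = of_real (chain_sign d 1 *
     (real CARD('n) / (real CARD('n) - 1) ^ (d - 1) / chain_mass d z) *
     (\<Sum>a\<in>UNIV. 1 / real CARD('n) - (if a = z then 1 else 0)))"
    unfolding trace_def chain_moment_def by (simp add: sum_distrib_left)
  also have "(\<Sum>a\<in>UNIV. 1 / real CARD('n) - (if a = z then 1 else 0)) = 0"
    by (simp add: sum_subtractf)
  finally have "trace (chain_moment d z 1) = 0" by simp
  then have "trace (chain_moment d z i) = 0" for i
    by (cases "i = 1") (auto simp: chain_moment_def trace_def)
  then show ?thesis
    using assms by (auto simp: real_diag_tuples_def chain_moment_def diagonal_def)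
qed

lemma trace_chain_moment_mult:
  fixes z :: "'n::finite"
  assumes A: "trace A = 0"
  shows "trace (chain_moment d z 1 ** A) = - of_real (chain_sign d 1 *
     (real CARD('n) / (real CARD('n) - 1) ^ (d - 1) / chain_mass d z)) * A $ z $ z"
proof -
  let ?q = "of_real (chain_sign d 1 *
     (real CARD('n) / (real CARD('n) - 1) ^ (d - 1) / chain_mass d z)) :: complex"
  have "trace (chain_moment d z 1 ** A) =
      (\<Sum>a\<in>UNIV. ?q * (1 / of_nat CARD('n) * A $ a $ a - (if a = z then A $ a $ a else 0)))"
    unfolding trace_def chain_moment_def if_P[OF refl] diag_mat_mult_left_nth
    by (intro sum.cong) (auto simp: algebra_simps)
  also have "\<dots> = ?q * (1 / of_nat CARD('n) * trace A - A $ z $ z)"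
    by (simp only: sum_distrib_left[symmetric] sum_subtractf trace_def sum.delta finite UNIV_I if_True)
  finally show ?thesis using A by simp
qed

text \<open>The diagonal vector \<open>1 / n - \<delta>\<close> has squared norm
  \<open>1 - 1 / n\<close>, which is below 1, and the factor \<open>n / chain_mass d z\<close> is at
  most 1 by \<open>chain_mass_ge\<close>.\<close>

lemma norm_chain_moment_le:
  fixes z :: "'n::finite"
  assumes n: "CARD('n) \<ge> 2" and d: "d \<ge> 2"
  shows "norm (chain_moment d z 1) \<le> 1 / (real CARD('n) - 1) ^ (d - 1)"
proof -
  let ?n = "real CARD('n)"
  let ?q = "?n / (?n - 1) ^ (d - 1) / chain_mass d z"
  have n2: "?n \<ge> 2" using n by simp
  have N: "chain_mass d z \<ge> ?n" by (rule chain_mass_ge[OF n d])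
  have "(norm (chain_moment d z 1))\<^sup>2 = (\<Sum>a\<in>UNIV. ?q\<^sup>2 * (1 / ?n - (if a = z then 1 else 0))\<^sup>2)"
  proof -
    have "(\<Sum>b\<in>UNIV. (cmod (chain_moment d z 1 $ a $ b))\<^sup>2) = ?q\<^sup>2 * (1 / ?n - (if a = z then 1 else 0))\<^sup>2" for a
    proof -
      have "(\<Sum>b\<in>UNIV. (cmod (chain_moment d z 1 $ a $ b))\<^sup>2) =
          (\<Sum>b\<in>UNIV. if a = b then (chain_sign d 1 * ?q * (1 / ?n - (if a = z then 1 else 0)))\<^sup>2 else 0)"
        unfolding chain_moment_def if_P[OF refl] diag_mat_nth
        by (intro sum.cong refl) (auto simp only: norm_of_real power2_abs norm_zero zero_power2 split: if_split)
      also have "\<dots> = (chain_sign d 1)\<^sup>2 * (?q\<^sup>2 * (1 / ?n - (if a = z then 1 else 0))\<^sup>2)"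
        by (simp only: sum.delta' finite UNIV_I if_True power_mult_distrib mult.assoc)
      finally show ?thesis by (simp add: chain_sign_def)
    qed
    then show ?thesis by (simp only: norm_matrix_power2)
  qed
  also have "\<dots> = ?q\<^sup>2 * (\<Sum>a\<in>UNIV. (1 / ?n - (if a = z then 1 else 0))\<^sup>2)"
    by (simp only: sum_distrib_left)
  \<comment> \<open>At \<open>a = z\<close> the square is
    \<open>(1 / n)\<^sup>2 + (1 - 2 / n)\<close>.\<close>
  also have "(\<Sum>a\<in>UNIV. (1 / ?n - (if a = z then 1 else 0))\<^sup>2) =
      (\<Sum>a\<in>UNIV. (1 / ?n)\<^sup>2 + (if a = z then 1 - 2 / ?n else 0))"
    by (intro sum.cong) (auto simp: power2_eq_square algebra_simps)
  also have "\<dots> = 1 - 1 / ?n"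
  proof -
    have "?n * (1 / ?n)\<^sup>2 = 1 / ?n" using n2 by (simp add: power2_eq_square)
    then show ?thesis by (simp add: sum.distrib)
  qed
  also have "?q\<^sup>2 * (1 - 1 / ?n) \<le> ?q\<^sup>2 * 1"
    by (intro mult_left_mono) auto
  finally have "(norm (chain_moment d z 1))\<^sup>2 \<le> ?q\<^sup>2" by simp
  moreover have "0 \<le> ?q" using n2 N by auto
  ultimately have "norm (chain_moment d z 1) \<le> ?q" by (rule power2_le_imp_le)
  also have "?q \<le> 1 / (?n - 1) ^ (d - 1)"
    using n2 N by (simp add: divide_simps)
  finally show ?thesis .
qed

lemma frob_norm_chain_moment_le:
  fixes z :: "'n::finite"
  assumes "CARD('n) \<ge> 2" and "d \<ge> 2" and V: "vertices Q = {1..d}"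
  shows "frob_norm Q (chain_moment d z) \<le> (real CARD('n) - 1) powi (- int d + 1)"
proof -
  have "(\<Sum>i\<in>{1..d}. (norm (chain_moment d z i))\<^sup>2) = (\<Sum>i\<in>{1}. (norm (chain_moment d z i))\<^sup>2)"
    using assms by (intro sum.mono_neutral_right) (auto simp: chain_moment_def)
  then have "frob_norm Q (chain_moment d z) = norm (chain_moment d z 1)"
    by (simp add: frob_norm_def V)
  also have "\<dots> \<le> 1 / (real CARD('n) - 1) ^ (d - 1)"
    using assms by (intro norm_chain_moment_le)
  also have "\<dots> = (real CARD('n) - 1) powi (- int (d - 1))"
    by (simp only: power_int_minus power_int_of_nat inverse_eq_divide)
  also have "- int (d - 1) = - int d + 1" using assms by simp
  finally show ?thesis .
qed

text \<open>Serves both bounds. The two assumptions on \<open>v\<close> say that its norm and its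
  pairing with the Lie algebra see only the squared entries of \<open>chain_rep\<close>; since
  \<open>chain_moment\<close> is real diagonal, it lies in either choice of
  \<open>P\<close>.\<close>

lemma moment_map_eq_chain_moment:
  fixes z :: "'n::finite" and v :: "'e \<Rightarrow> 'n cmat"
  assumes n: "CARD('n) \<ge> 2" and d: "d \<ge> 2" and V: "vertices Q = {1..d}"
    and P: "P = herm_tuples Q \<or> P = real_diag_tuples Q"
    and norm: "rep_inner Q v v = of_real (chain_mass d z)"
    and pairing: "\<And>A. A \<in> P \<Longrightarrow> rep_inner Q v (lie_act Q A v) =
      (\<Sum>j=1..d-1. \<Sum>r\<in>UNIV. \<Sum>c\<in>UNIV. of_real ((cmod (chain_rep d z j $ r $ c))\<^sup>2) *
        (A (tgt (alt_quiver d) j) $ r $ r - A (src (alt_quiver d) j) $ c $ c))"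
  shows "moment_map Q P v = chain_moment d z"
proof (rule moment_map_eqI)
  show "finite (vertices Q)" by (simp add: V)
  show P_herm: "P \<subseteq> herm_tuples Q"
    using P real_diag_tuples_subset_herm_tuples by auto
  show "(\<lambda>i. A i - B i) \<in> P" if "A \<in> P" "B \<in> P" for A B
    using P
  proof
    assume "P = herm_tuples Q"
    then show ?thesis
      using that by (auto simp: herm_tuples_def conj_transpose_def vec_eq_iff trace_sub)
  next
    assume "P = real_diag_tuples Q"
    then show ?thesis
      using that by (auto simp: real_diag_tuples_def diagonal_def trace_sub)
  qed
  show "chain_moment d z \<in> P"
    using P chain_moment_in_real_diag_tuples[OF V d, of z] real_diag_tuples_subset_herm_tuples[of Q] by auto
  fix A assume A: "A \<in> P"
  have tr: "trace (A i) = 0" if "i \<in> {1..d}" for i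
    using A P_herm that V by (auto simp: herm_tuples_def)
  let ?N = "chain_mass d z" and ?u = "real CARD('n) / (real CARD('n) - 1) ^ (d - 1)"
  have N: "?N \<noteq> 0" using chain_mass_ge[OF n d, of z] n by auto
  have "rep_inner Q v (lie_act Q A v) = (\<Sum>j=1..d-1. \<Sum>a\<in>UNIV. \<Sum>b\<in>UNIV.
      of_real (chain_weight d z j a b) * (of_real (chain_sign d j) * A j $ a $ a +
        of_real (chain_sign d (j + 1)) * A (j + 1) $ b $ b))"
    unfolding pairing[OF A] using chain_rep_pairing[of d z _ "\<lambda>i a. A i $ a $ a"]
    by (simp only:)
  also have "\<dots> = - of_real ?u * (of_real (chain_sign d 1) * A 1 $ z $ z)"
    using tr by (intro chain_weight_pairing[OF n d])
      (simp add: sum_distrib_left[symmetric] trace_def)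
  finally have eq: "rep_inner Q v (lie_act Q A v) = - of_real ?u * (of_real (chain_sign d 1) * A 1 $ z $ z)" .
  have "(\<Sum>i\<in>vertices Q. trace (chain_moment d z i ** A i)) =
      (\<Sum>i\<in>{1}. trace (chain_moment d z i ** A i))"
    using d unfolding V by (intro sum.mono_neutral_right) (auto simp: chain_moment_def trace_def)
  also have "\<dots> = - of_real (chain_sign d 1 * (?u / ?N)) * A 1 $ z $ z"
    using trace_chain_moment_mult[of "A 1" d z] tr[of 1] d by simp
  also have "\<dots> = rep_inner Q v (lie_act Q A v) / rep_inner Q v v"
    unfolding eq norm using N by simp
  finally show "(\<Sum>i\<in>vertices Q. trace (chain_moment d z i ** A i)) =
    rep_inner Q v (lie_act Q A v) / rep_inner Q v v" .
qed

text \<open>Also serves both bounds: \<open>p\<close> sends an arrow to the arrow of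
  \<open>alt_quiver d\<close> that it copies, and only the support of \<open>v\<close> matters for
  the contraction.\<close>

lemma chain_unstable:
  fixes z :: "'n::finite" and v :: "'e \<Rightarrow> 'n cmat"
  assumes n: "CARD('n) \<ge> 2"
    and arr: "\<And>e. e \<in> arrows Q \<Longrightarrow> p e \<in> {1..d-1}"
    and src: "\<And>e. e \<in> arrows Q \<Longrightarrow> src Q e = src (alt_quiver d) (p e)"
    and tgt: "\<And>e. e \<in> arrows Q \<Longrightarrow> tgt Q e = tgt (alt_quiver d) (p e)"
    and v: "\<And>e r c. e \<in> arrows Q \<Longrightarrow> v e $ r $ c \<noteq> 0 \<Longrightarrow> chain_rep d z (p e) $ r $ c \<noteq> 0"
  shows "unstable Q (ST_tuples Q) v"
proof -
  let ?n = "real CARD('n)"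
  \<comment> \<open>On the last arrow the exponents are -1 at \<open>a \<noteq> z\<close> and 0 at
    vertex \<open>d\<close>; the explicit 0 is essential, as truncated subtraction would give -1 at
    \<open>i = d\<close>. On an earlier arrow,
    \<open>- n^(d-1-j) + (n - 1) * n^(d-2-j) = - n^(d-2-j)\<close>.\<close>
  define s where "s i = (if i \<ge> d then 0 else - (?n ^ (d - 1 - i)))" for i
  define k where "k i a = s i * (if a = z then 1 - ?n else 1)" for i and a :: 'n
  have n2: "?n \<ge> 2" using n by simp
  have neg: "k j a + k (j + 1) b < 0" if "chain_weight d z j a b \<noteq> 0" "j \<in> {1..d-1}" for j a b
  proof (cases "j = d - 1")
    case True
    then show ?thesis using that by (auto simp: k_def s_def chain_weight_def split: if_splits)
  next
    case False
    have a: "a \<noteq> z" "b = z" using that False by (auto simp: chain_weight_def split: if_splits)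
    have "d - 1 - j = Suc (d - 1 - (j + 1))" using that False by auto
    then have "?n ^ (d - 1 - j) = ?n * ?n ^ (d - 1 - (j + 1))" by simp
    moreover have "?n ^ (d - 1 - (j + 1)) > 0" using n2 by simp
    moreover have "\<not> d \<le> j" "\<not> d \<le> j + 1" using that False by auto
    ultimately show ?thesis
      using a by (simp add: k_def s_def algebra_simps)
  qed
  show ?thesis
  proof (rule unstable_if_one_parameter_subgroup[where h = "\<lambda>i a. chain_sign d i * k i a"])
    fix i
    have "(\<Sum>a\<in>UNIV. if a = z then 1 - ?n else 1) = (\<Sum>a\<in>UNIV. 1 - (if a = z then ?n else 0))"
      by (intro sum.cong) auto
    also have "\<dots> = 0" by (simp add: sum_subtractf)
    finally show "(\<Sum>a\<in>UNIV. chain_sign d i * k i a) = 0"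
      unfolding k_def by (simp add: sum_distrib_left[symmetric])
  next
    fix e r c assume e: "e \<in> arrows Q" "v e $ r $ c \<noteq> 0"
    then have "chain_rep d z (p e) $ r $ c \<noteq> 0" by (rule v)
    then show "chain_sign d (tgt Q e) * k (tgt Q e) r < chain_sign d (src Q e) * k (src Q e) c"
      using neg[of "p e" c r] neg[of "p e" r c] arr[OF e(1)]
      by (auto simp: src[OF e(1)] tgt[OF e(1)] alt_quiver_def chain_rep_def chain_sign_def split: if_splits)
  qed
qed

text \<open>The addition table of the integers modulo \<open>n\<close>, transported to the index
  type and shifted by 1 because copies are numbered from 1.\<close>

lemma latin_square:
  obtains L :: "'n::finite \<Rightarrow> 'n \<Rightarrow> nat"
  where "\<And>a b. L a b \<in> {1..CARD('n)}" and "\<And>a b c. L a c = L b c \<Longrightarrow> a = b"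
    and "\<And>a b c. L c a = L c b \<Longrightarrow> a = b"
proof -
  obtain f :: "'n \<Rightarrow> nat" where f: "bij_betw f UNIV {0..<CARD('n)}"
    using ex_bij_betw_finite_nat[of "UNIV :: 'n set"] by auto
  have lt: "f a < CARD('n)" for a using f by (auto simp: bij_betw_def)
  have inj: "f a = f b \<Longrightarrow> a = b" for a b using f by (auto simp: bij_betw_def inj_on_def)
  have cancel: "a = b" if "(f a + f c) mod CARD('n) = (f b + f c) mod CARD('n)" for a b c
  proof (rule inj)
    have "(x + f c) mod CARD('n) = (if x + f c < CARD('n) then x + f c else x + f c - CARD('n))"
      if "x < CARD('n)" for x
      using that lt[of c] by (simp add: le_mod_geq)
    then show "f a = f b"
      using that lt[of a] lt[of b] lt[of c] by (auto split: if_splits)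
  qed
  show thesis
  proof (rule that[of "\<lambda>a b. (f a + f b) mod CARD('n) + 1"])
    show "(f a + f b) mod CARD('n) + 1 \<in> {1..CARD('n)}" for a b
      using mod_less_divisor[of "CARD('n)" "f a + f b"] by (simp add: Suc_leI)
  qed (use cancel in \<open>auto simp: add.commute\<close>)
qed

section \<open>The bounds\<close>

text \<open>Torus directions are diagonal, so the hypotheses of \<open>trace_moment_eq\<close> hold
  for every matrix and \<open>chain_rep\<close> itself is a witness on a single copy of the
  quiver.\<close>

lemma weight_margin_alt_quiver_le:
  assumes n: "CARD('n::finite) \<ge> 2" and d: "d \<ge> 2"
  shows "weight_margin TYPE('n) (alt_quiver d) \<le> (real CARD('n) - 1) powi (- int d + 1)"
proof -
  fix z :: 'n
  let ?Q = "alt_quiver d"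
  define v where "v j = (if j \<in> {1..d-1} then chain_rep d z j else 0)" for j
  have V: "vertices ?Q = {1..d}" and E: "arrows ?Q = {1..d-1}"
    by (simp_all add: alt_quiver_def)
  have norm: "rep_inner ?Q v v = of_real (chain_mass d z)"
    unfolding rep_inner_def E chain_mass_def of_real_sum[of _ "{1..d-1}"]
    by (intro sum.cong refl) (simp only: v_def if_True trace_conj_transpose_self sum_chain_rep_power2)
  have pairing: "rep_inner ?Q v (lie_act ?Q A v) =
      (\<Sum>j=1..d-1. \<Sum>r\<in>UNIV. \<Sum>c\<in>UNIV. of_real ((cmod (chain_rep d z j $ r $ c))\<^sup>2) *
        (A (tgt ?Q j) $ r $ r - A (src ?Q j) $ c $ c))"
    if A: "A \<in> real_diag_tuples ?Q" for A
    unfolding rep_inner_def E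
  proof (intro sum.cong refl)
    fix j assume j: "j \<in> {1..d-1}"
    then have "tgt ?Q j \<in> {1..d}" "src ?Q j \<in> {1..d}" by (auto simp: alt_quiver_def)
    then have "diagonal (A (tgt ?Q j))" "diagonal (A (src ?Q j))"
      using A V by (auto simp: real_diag_tuples_def)
    then show "trace (conj_transpose (v j) ** lie_act ?Q A v j) =
        (\<Sum>r\<in>UNIV. \<Sum>c\<in>UNIV. of_real ((cmod (chain_rep d z j $ r $ c))\<^sup>2) *
        (A (tgt ?Q j) $ r $ r - A (src ?Q j) $ c $ c))"
      using j by (simp add: lie_act_eq E v_def trace_moment_eq diagonal_def)
  qed
  have "v \<in> reps ?Q" by (simp add: reps_def E v_def)
  moreover have "v \<noteq> (\<lambda>_. 0)"
    using norm chain_mass_ge[OF n d, of z] n by (auto simp: rep_inner_def trace_def)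
  moreover have "unstable ?Q (ST_tuples ?Q) v"
    by (rule chain_unstable[OF n, where p = "\<lambda>j. j" and z = z]) (auto simp: E v_def)
  ultimately have "weight_margin TYPE('n) ?Q \<le> frob_norm ?Q (moment_map ?Q (real_diag_tuples ?Q) v)"
    unfolding weight_margin_def
    by (intro cInf_lower bdd_belowI[of _ 0]) (auto simp: frob_norm_def intro!: sum_nonneg)
  also have "moment_map ?Q (real_diag_tuples ?Q) v = chain_moment d z"
    by (rule moment_map_eq_chain_moment[OF n d V _ norm pairing]) auto
  also have "frob_norm ?Q (chain_moment d z) \<le> (real CARD('n) - 1) powi (- int d + 1)"
    by (rule frob_norm_chain_moment_le[OF n d V])
  finally show ?thesis .
qed

text \<open>The witness has the squared entries of the single-copy witness, distributed over the
  copies, so the norm, the moment tuple and the contracting subgroup carry over.\<close>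

lemma gap_copies_alt_quiver_le:
  assumes n: "CARD('n::finite) \<ge> 2" and d: "d \<ge> 2"
  shows "gap TYPE('n) (copies CARD('n) (alt_quiver d)) \<le> (real CARD('n) - 1) powi (- int d + 1)"
proof -
  fix z :: 'n
  let ?Q = "copies CARD('n) (alt_quiver d)"
  obtain L :: "'n \<Rightarrow> 'n \<Rightarrow> nat" where L: "\<And>a b. L a b \<in> {1..CARD('n)}"
    and L1: "\<And>a b c. L a c = L b c \<Longrightarrow> a = b" and L2: "\<And>a b c. L c a = L c b \<Longrightarrow> a = b"
    using latin_square by blast
  \<comment> \<open>Spreading the entries over the copies along a Latin square leaves at most one nonzero entry in
    each row and column of each copy, so the moment map has no off-diagonal part.\<close>
  define X :: "nat \<Rightarrow> nat \<Rightarrow> 'n cmat"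
    where "X j k = (\<chi> r c. if L r c = k then chain_rep d z j $ r $ c else 0)" for j k
  define v where "v e = (if e \<in> arrows ?Q then X (fst e) (snd e) else 0)" for e
  have V: "vertices ?Q = {1..d}" and E: "arrows ?Q = {1..d-1} \<times> {1..CARD('n)}"
    by (simp_all add: copies_def alt_quiver_def)
  have sum_arrows: "(\<Sum>e\<in>arrows ?Q. F e) = (\<Sum>j=1..d-1. \<Sum>k=1..CARD('n). F (j, k))"
    for F :: "nat \<times> nat \<Rightarrow> complex"
    by (simp add: E sum.cartesian_product)
  \<comment> \<open>The entry at \<open>(r, c)\<close> survives in exactly one copy, the one
    numbered \<open>L r c\<close>.\<close>
  have collect: "(\<Sum>k=1..CARD('n). \<Sum>r\<in>UNIV. \<Sum>c\<in>UNIV. of_real ((cmod (X j k $ r $ c))\<^sup>2) * f r c) =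
      (\<Sum>r\<in>UNIV. \<Sum>c\<in>UNIV. of_real ((cmod (chain_rep d z j $ r $ c))\<^sup>2) * f r c)"
    for j and f :: "'n \<Rightarrow> 'n \<Rightarrow> complex"
  proof -
    have "(\<Sum>k=1..CARD('n). \<Sum>r\<in>UNIV. \<Sum>c\<in>UNIV. of_real ((cmod (X j k $ r $ c))\<^sup>2) * f r c) =
        (\<Sum>r\<in>UNIV. \<Sum>c\<in>UNIV. \<Sum>k=1..CARD('n). of_real ((cmod (X j k $ r $ c))\<^sup>2) * f r c)"
      by (subst sum.swap) (intro sum.cong refl sum.swap)
    also have "\<dots> = (\<Sum>r\<in>UNIV. \<Sum>c\<in>UNIV. \<Sum>k=1..CARD('n).
        if L r c = k then of_real ((cmod (chain_rep d z j $ r $ c))\<^sup>2) * f r c else 0)"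
      by (intro sum.cong refl) (simp add: X_def)
    finally show ?thesis using L by simp
  qed
  have "rep_inner ?Q v v = (\<Sum>j=1..d-1. \<Sum>k=1..CARD('n). \<Sum>r\<in>UNIV. \<Sum>c\<in>UNIV.
      of_real ((cmod (X j k $ r $ c))\<^sup>2) * 1)"
    unfolding rep_inner_def sum_arrows
    by (intro sum.cong refl) (simp add: v_def E trace_conj_transpose_self)
  also have "\<dots> = of_real (\<Sum>j=1..d-1. \<Sum>r\<in>UNIV. \<Sum>c\<in>UNIV. (cmod (chain_rep d z j $ r $ c))\<^sup>2)"
    unfolding collect by simp
  finally have norm: "rep_inner ?Q v v = of_real (chain_mass d z)"
    by (simp only: sum_chain_rep_power2 chain_mass_def)
  have pairing: "rep_inner ?Q v (lie_act ?Q A v) =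
      (\<Sum>j=1..d-1. \<Sum>r\<in>UNIV. \<Sum>c\<in>UNIV. of_real ((cmod (chain_rep d z j $ r $ c))\<^sup>2) *
        (A (tgt (alt_quiver d) j) $ r $ r - A (src (alt_quiver d) j) $ c $ c))" for A
  proof -
    \<comment> \<open>Two nonzero entries of \<open>X j k\<close> in one column would contradict
      \<open>L1\<close>, and two in one row would contradict \<open>L2\<close>; hence
      \<open>B\<close> and \<open>C\<close> may be arbitrary.\<close>
    have tr: "trace (conj_transpose (X j k) ** (B ** X j k - X j k ** C)) =
        (\<Sum>r\<in>UNIV. \<Sum>c\<in>UNIV. of_real ((cmod (X j k $ r $ c))\<^sup>2) * (B $ r $ r - C $ c $ c))" for j k B C
      by (rule trace_moment_eq) (auto simp: X_def dest: L1 L2)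
    have "rep_inner ?Q v (lie_act ?Q A v) = (\<Sum>j=1..d-1. \<Sum>k=1..CARD('n). \<Sum>r\<in>UNIV. \<Sum>c\<in>UNIV.
        of_real ((cmod (X j k $ r $ c))\<^sup>2) *
        (A (tgt (alt_quiver d) j) $ r $ r - A (src (alt_quiver d) j) $ c $ c))"
      unfolding rep_inner_def sum_arrows
    proof (intro sum.cong refl)
      fix j k assume "j \<in> {1..d-1}" "k \<in> {1..CARD('n)}"
      moreover have "tgt ?Q (j, k) = tgt (alt_quiver d) j" "src ?Q (j, k) = src (alt_quiver d) j"
        by (simp_all add: copies_def)
      ultimately show "trace (conj_transpose (v (j, k)) ** lie_act ?Q A v (j, k)) =
          (\<Sum>r\<in>UNIV. \<Sum>c\<in>UNIV. of_real ((cmod (X j k $ r $ c))\<^sup>2) *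
            (A (tgt (alt_quiver d) j) $ r $ r - A (src (alt_quiver d) j) $ c $ c))"
        using tr by (simp add: lie_act_eq E v_def)
    qed
    then show ?thesis unfolding collect .
  qed
  have "v \<in> reps ?Q" by (simp add: reps_def v_def)
  moreover have "v \<noteq> (\<lambda>_. 0)"
    using norm chain_mass_ge[OF n d, of z] n by (auto simp: rep_inner_def trace_def)
  \<comment> \<open>The contracting subgroup lies in the torus, which is contained in the full
    group.\<close>
  moreover have "unstable ?Q (SL_tuples ?Q) v"
  proof (rule unstable_mono)
    show "unstable ?Q (ST_tuples ?Q) v"
      by (rule chain_unstable[OF n, where p = fst and z = z])
        (auto simp: v_def X_def copies_def alt_quiver_def split: if_splits)
  qed (auto simp: ST_tuples_def)
  ultimately have "gap TYPE('n) ?Q \<le> frob_norm ?Q (moment_map ?Q (herm_tuples ?Q) v)"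
    unfolding gap_def
    by (intro cInf_lower bdd_belowI[of _ 0]) (auto simp: frob_norm_def intro!: sum_nonneg)
  also have "moment_map ?Q (herm_tuples ?Q) v = chain_moment d z"
    by (rule moment_map_eq_chain_moment[OF n d V _ norm pairing]) auto
  also have "frob_norm ?Q (chain_moment d z) \<le> (real CARD('n) - 1) powi (- int d + 1)"
    by (rule frob_norm_chain_moment_le[OF n d V])
  finally show ?thesis .
qed

theorem theorem4p25:
  fixes d :: nat
  assumes "CARD('n::finite) \<ge> 2" and "d \<ge> 2"
  shows "weight_margin TYPE('n) (alt_quiver d) \<le> (real CARD('n) - 1) powi (- int d + 1) \<and>
    gap TYPE('n) (copies CARD('n) (alt_quiver d)) \<le> (real CARD('n) - 1) powi (- int d + 1)"
  using weight_margin_alt_quiver_le[OF assms] gap_copies_alt_quiver_le[OF assms] by blast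

end
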